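(* Let $\Gamma$ be a set and let $K$ be a compact subspace of $\Sigma(\mathbb{R}^\Gamma)$ of cardinality at most the continuum $\mathfrak{c}$. If $K$ has the property $\mathcal{E}_2(\aleph_1)$, then $K$ is an $L\Sigma(\leq\omega)$-space.
   Context: All spaces are Tychonoff. For a set $\Gamma$ and $x\in\mathbb{R}^\Gamma$, $\operatorname{supp} x=\{\gamma\in\Gamma:x(\gamma)\neq 0\}$, and $\Sigma(\mathbb{R}^\Gamma)=\{x\in\mathbb{R}^\Gamma:|\operatorname{supp}x|\leq\omega\}$ with the subspace topology from the product $\mathbb{R}^\Gamma$. A compact subspace $K$ of some $\Sigma(\mathbb{R}^\Gamma)$ has the property $\mathcal{E}_2(\aleph_1)$ if there is a sequence $(\Gamma_n)_{n\in\omega}$ of subsets of $\Gamma$ such that if, for $x\in K$, we let $N_x=\{n\in\omega:|\operatorname{supp}x\cap\Gamma_n|<\aleph_0\}$, then the set $\Gamma\setminus\bigcup_{n\in N_x}\Gamma_n$ is countable (for every $x\in K$). A set-valued map $p:M\to X$ between spaces assigns to every point of $M$ a subset of $X$. It is onto if $\bigcup\{p(z):z\in M\}=X$; compact-valued if each $p(z)$ is compact; upper semicontinuous if for every open $U\subseteq X$ the set $\{z\in M:p(z)\subseteq U\}$ is open in $M$. A space $X$ is an $L\Sigma(\leq\omega)$-space if there are a separable metrizable space $M$ and a compact-valued upper semicontinuous onto set-valued map $p:M\to X$ such that $p(z)$ is metrizable for all $z\in M$. *)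

theory Defs
  imports "HOL-Analysis.Analysis"
begin

definition supp_on :: "'a set \<Rightarrow> ('a \<Rightarrow> real) \<Rightarrow> 'a set" where
  "supp_on \<Gamma> x = {\<gamma> \<in> \<Gamma>. x \<gamma> \<noteq> 0}"

text \<open>Points of the product are the extensional functions on \<open>\<Gamma>\<close>, as usual for
  \<^const>\<open>product_topology\<close>; off \<open>\<Gamma>\<close> they take the
  dummy value \<^const>\<open>undefined\<close>, so the support is cut down to \<open>\<Gamma>\<close>.\<close>

definition Sigma_product :: "'a set \<Rightarrow> ('a \<Rightarrow> real) topology" where
  "Sigma_product \<Gamma> =
     subtopology (product_topology (\<lambda>_. euclideanreal) \<Gamma>)
       {x \<in> \<Gamma> \<rightarrow>\<^sub>E UNIV. countable (supp_on \<Gamma> x)}"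

definition property_E2_aleph1 :: "'a set \<Rightarrow> ('a \<Rightarrow> real) set \<Rightarrow> bool" where
  "property_E2_aleph1 \<Gamma> K \<longleftrightarrow>
     (\<exists>G :: nat \<Rightarrow> 'a set. (\<forall>n. G n \<subseteq> \<Gamma>) \<and>
        (\<forall>x\<in>K. countable (\<Gamma> - (\<Union>n \<in> {n. finite (supp_on \<Gamma> x \<inter> G n)}. G n))))"

definition onto_set_valued :: "'b topology \<Rightarrow> 'a topology \<Rightarrow> ('b \<Rightarrow> 'a set) \<Rightarrow> bool" where
  "onto_set_valued M X p \<longleftrightarrow> (\<Union>z\<in>topspace M. p z) = topspace X"

definition compact_valued :: "'b topology \<Rightarrow> 'a topology \<Rightarrow> ('b \<Rightarrow> 'a set) \<Rightarrow> bool" where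
  "compact_valued M X p \<longleftrightarrow> (\<forall>z\<in>topspace M. compactin X (p z))"

definition upper_semicontinuous_set_valued ::
    "'b topology \<Rightarrow> 'a topology \<Rightarrow> ('b \<Rightarrow> 'a set) \<Rightarrow> bool" where
  "upper_semicontinuous_set_valued M X p \<longleftrightarrow>
     (\<forall>U. openin X U \<longrightarrow> openin M {z \<in> topspace M. p z \<subseteq> U})"

definition LSigma_witness :: "'b topology \<Rightarrow> 'a topology \<Rightarrow> ('b \<Rightarrow> 'a set) \<Rightarrow> bool" where
  "LSigma_witness M X p \<longleftrightarrow>
     separable_space M \<and> metrizable_space M \<and>
     compact_valued M X p \<and> upper_semicontinuous_set_valued M X p \<and> onto_set_valued M X p \<and>
     (\<forall>z\<in>topspace M. metrizable_space (subtopology X (p z)))"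

text \<open>The space \<open>M\<close> ranges over arbitrary topologies on arbitrary sets of reals. This loses no
  generality, since a separable metrizable space has at most continuum many points; see
  \<open>LSigma_le_omega_spaceI\<close> below.\<close>

definition LSigma_le_omega_space :: "'a topology \<Rightarrow> bool" where
  "LSigma_le_omega_space X \<longleftrightarrow> (\<exists>(M :: real topology) p. LSigma_witness M X p)"

lemma separable_metrizable_lepoll_reals:
  fixes M :: "'b topology"
  assumes "separable_space M" "metrizable_space M"
  shows "topspace M \<lesssim> (UNIV :: real set)"
proof -
  obtain S d where S: "Metric_space S d" and M: "M = Metric_space.mtopology S d"
    using assms(2) by (auto simp: metrizable_space_def)
  interpret Metric_space S d by fact
  obtain D where D: "countable D" "D \<subseteq> S" "mtopology closure_of D = S"
    using assms(1) by (auto simp: M separable_space_def)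
  define h where "h x = {(a, q :: rat). a \<in> D \<and> d a x < of_rat q}" for x
  have "x = y" if x: "x \<in> S" and y: "y \<in> S" and h: "h x = h y" for x y
  proof (rule ccontr)
    assume "x \<noteq> y"
    then have pos: "d x y > 0" using x y by simp
    then obtain a where a: "a \<in> D" "d x a < d x y / 2"
      using D(3) x by (fastforce simp: metric_closure_of dest!: spec[of _ "d x y / 2"])
    have aS: "a \<in> S" using a D by auto
    have "d a x < d a y"
      using a triangle[OF x aS y] commute[of a x] by linarith
    then obtain q where "d a x < of_rat q" "of_rat q < d a y"
      using of_rat_dense by blast
    then have "(a, q) \<in> h x" "(a, q) \<notin> h y" using a by (auto simp: h_def)
    then show False using h by simp
  qed
  then have "inj_on h S" by (auto intro: inj_onI)
  moreover have "h ` S \<subseteq> Pow (D \<times> UNIV)" by (auto simp: h_def)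
  ultimately have 1: "S \<lesssim> Pow (D \<times> (UNIV :: rat set))" by (auto simp: lepoll_def)
  have "countable (D \<times> (UNIV :: rat set))" using D by simp
  then obtain e :: "'b \<times> rat \<Rightarrow> nat" where "inj_on e (D \<times> UNIV)"
    unfolding countable_def by auto
  then have "Pow (D \<times> (UNIV :: rat set)) \<lesssim> (UNIV :: nat set set)"
    unfolding lepoll_def by (meson inj_on_image_Pow subset_UNIV)
  then show ?thesis
    using 1 nat_sets_eqpoll_reals by (simp add: M) (meson eqpoll_imp_lepoll lepoll_trans)
qed

lemma LSigma_le_omega_spaceI:
  fixes M :: "'b topology"
  assumes "LSigma_witness M X p"
  shows "LSigma_le_omega_space X"
proof -
  have "topspace M \<lesssim> (UNIV :: real set)"
    using assms separable_metrizable_lepoll_reals by (auto simp: LSigma_witness_def)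
  then obtain f :: "'b \<Rightarrow> real" where f: "inj_on f (topspace M)"
    by (auto simp: lepoll_def)
  define g where "g = inv_into (topspace M) f"
  define N where "N = pullback_topology (f ` topspace M) g M"
  have gf: "g (f z) = z" if "z \<in> topspace M" for z using f that by (simp add: g_def)
  have top: "topspace N = f ` topspace M"
    by (auto simp: N_def topspace_pullback_topology gf)
  have opn: "openin N S \<longleftrightarrow> (\<exists>U. openin M U \<and> S = g -` U \<inter> f ` topspace M)" for S
    by (simp add: N_def openin_pullback_topology)
  have "homeomorphic_maps N M g f"
    unfolding homeomorphic_maps_def
  proof (intro conjI)
    show "continuous_map N M g"
      by (auto simp: continuous_map_def top gf opn)
    show "continuous_map M N f"
    proof -
      have "{x \<in> topspace M. f x \<in> g -` U \<inter> f ` topspace M} = U" if "openin M U" for U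
        using openin_subset[OF that] f by (auto simp: gf dest: inj_onD)
      then show ?thesis by (auto simp: continuous_map_def top opn)
    qed
  qed (auto simp: top gf)
  then have hom: "N homeomorphic_space M" by (auto simp: homeomorphic_space_def)
  have "LSigma_witness N X (p \<circ> g)"
    unfolding LSigma_witness_def
  proof (intro conjI)
    show "separable_space N" "metrizable_space N"
      using assms hom homeomorphic_separable_space homeomorphic_metrizable_space
      by (auto simp: LSigma_witness_def)
    show "upper_semicontinuous_set_valued N X (p \<circ> g)"
      unfolding upper_semicontinuous_set_valued_def opn
    proof (intro allI impI)
      fix U assume "openin X U"
      then have "openin M {z \<in> topspace M. p z \<subseteq> U}"
        using assms by (simp add: LSigma_witness_def upper_semicontinuous_set_valued_def)
      then show "\<exists>V. openin M V \<and> {z \<in> topspace N. (p \<circ> g) z \<subseteq> U} = g -` V \<inter> f ` topspace M"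
        by (intro exI[of _ "{z \<in> topspace M. p z \<subseteq> U}"]) (auto simp: top gf)
    qed
  qed (use assms in \<open>auto simp: LSigma_witness_def compact_valued_def onto_set_valued_def top gf\<close>)
  then show ?thesis by (auto simp: LSigma_le_omega_space_def)
qed

end

theory Submission
  imports Defs
begin

text \<open>A point \<open>x\<close> is put into the fibre of all \<open>y \<in> K\<close> which vanish on \<open>G\<^sub>n \<inter> B\<close> whenever
  \<open>supp x \<inter> G\<^sub>n\<close> is finite and \<open>supp x\<close> misses \<open>G\<^sub>n \<inter> B\<close>, where \<open>B\<close> runs through a countable
  family that separates points of \<open>\<Gamma>\<close> from finite sets; such a family exists because only
  continuum many coordinates matter. For \<open>y\<close> in this fibre \<open>supp y \<inter> G\<^sub>n \<subseteq> supp x\<close> for those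
  \<open>n\<close>, so all supports in the fibre lie in one countable set and the fibre is metrizable.
  Only countably many closed sets \<open>F\<^sub>k\<close> are used to cut out the fibres, and on
  \<open>\<real>\<^sup>\<nat>\<close> the map sending \<open>z\<close> to the intersection of all \<open>F\<^sub>k\<close> with
  \<open>z\<^sub>k \<noteq> 0\<close> is upper semicontinuous by compactness.\<close>

lemma open_Collect_coords_neq:
  fixes c :: real
  assumes "finite J"
  shows "open {z :: nat \<Rightarrow> real. \<forall>n\<in>J. z n \<noteq> c}"
proof -
  have "open {z :: nat \<Rightarrow> real. z n \<noteq> c}" for n
    by (intro open_Collect_neq continuous_on_product_coordinates continuous_on_const)
  then have "open (\<Inter>n\<in>J. {z :: nat \<Rightarrow> real. z n \<noteq> c})"
    using assms by (intro open_INT) auto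
  moreover have "(\<Inter>n\<in>J. {z :: nat \<Rightarrow> real. z n \<noteq> c}) = {z. \<forall>n\<in>J. z n \<noteq> c}"
    by auto
  ultimately show ?thesis by simp
qed

text \<open>\<open>U\<close> and the complements of the \<open>F i\<close> cover the compact space;
  the complements in a finite subcover give \<open>J\<close>. So whether an intersection lies in an
  open set is decided by finitely many of its members.\<close>

lemma compact_space_finite_Inter_subset:
  assumes "compact_space X" and "\<And>i. i \<in> I \<Longrightarrow> closedin X (F i)"
    and "openin X U" and "topspace X \<inter> (\<Inter>i\<in>I. F i) \<subseteq> U"
  obtains J where "finite J" "J \<subseteq> I" "topspace X \<inter> (\<Inter>i\<in>J. F i) \<subseteq> U"
proof -
  let ?C = "\<lambda>i. topspace X - F i"
  have "\<exists>\<F>. finite \<F> \<and> \<F> \<subseteq> insert U (?C ` I) \<and> topspace X \<subseteq> \<Union>\<F>"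
    using assms by (intro compactinD[of X "topspace X"]) (auto simp: compact_space_def)
  then obtain \<F> where \<F>: "finite \<F>" "\<F> \<subseteq> insert U (?C ` I)" "topspace X \<subseteq> \<Union>\<F>"
    by blast
  have "finite (\<F> - {U})" "\<F> - {U} \<subseteq> ?C ` I" using \<F> by auto
  then obtain J where J: "J \<subseteq> I" "finite J" "\<F> - {U} = ?C ` J"
    by (meson finite_subset_image)
  have "topspace X \<inter> (\<Inter>i\<in>J. F i) \<subseteq> U"
  proof
    fix x assume x: "x \<in> topspace X \<inter> (\<Inter>i\<in>J. F i)"
    then obtain S where "S \<in> \<F>" "x \<in> S" using \<F>(3) by auto
    then show "x \<in> U" using x J(3) by (cases "S = U") auto
  qed
  then show ?thesis using J that by blast
qed

lemma second_countable_euclidean: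
  "second_countable (euclidean :: 'b::second_countable_topology topology)"
proof -
  obtain B :: "'b set set" where "countable B" "topological_basis B"
    using ex_countable_basis by blast
  then show ?thesis
    unfolding second_countable_def topological_basis_def
    by (metis UnionE Union_upper open_openin subset_eq)
qed

text \<open>A subfamily of the \<open>F n\<close> is coded by the nonzero coordinates of a real
  sequence, because being nonzero is an open condition. Keeping only the codes of metrizable
  intersections leaves a subspace of a separable metrizable space, and \<open>cov\<close> says that
  these intersections still cover \<open>X\<close>.\<close>

lemma LSigma_le_omega_space_closed_family:
  fixes F :: "nat \<Rightarrow> 'a set"
  assumes X: "compact_space X" and F: "\<And>n. closedin X (F n)"
    and cov: "\<And>x. x \<in> topspace X \<Longrightarrow>
      \<exists>I. x \<in> (\<Inter>n\<in>I. F n) \<and> metrizable_space (subtopology X (\<Inter>n\<in>I. F n))"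
  shows "LSigma_le_omega_space X"
proof -
  \<comment> \<open>Intersecting with \<open>topspace X\<close> gives the right value at
    \<open>z = 0\<close>, where the index set is empty.\<close>
  define p where "p z = topspace X \<inter> (\<Inter>n\<in>{n. z n \<noteq> 0}. F n)" for z :: "nat \<Rightarrow> real"
  define S where "S = {z. metrizable_space (subtopology X (p z))}"
  have "LSigma_witness (top_of_set S) X p"
    unfolding LSigma_witness_def
  proof (intro conjI)
    \<comment> \<open>Separability need not pass to subspaces, but second countability does.\<close>
    show "separable_space (top_of_set S)"
      by (intro second_countable_imp_separable_space second_countable_subtopology
          second_countable_euclidean)
    show "metrizable_space (top_of_set S)"
      by (intro metrizable_space_subtopology metrizable_space_euclidean)
    show "\<forall>z\<in>topspace (top_of_set S). metrizable_space (subtopology X (p z))"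
      by (simp add: S_def)
    have "closedin X (p z)" for z
    proof -
      have "p z = \<Inter>(insert (topspace X) (F ` {n. z n \<noteq> 0}))" by (simp add: p_def)
      moreover have "closedin X (\<Inter>(insert (topspace X) (F ` {n. z n \<noteq> 0})))"
        using F by (intro closedin_Inter) auto
      ultimately show ?thesis by simp
    qed
    then show "compact_valued (top_of_set S) X p"
      using X by (simp add: compact_valued_def closedin_compact_space)
    show "onto_set_valued (top_of_set S) X p"
      unfolding onto_set_valued_def
    proof
      show "(\<Union>z\<in>topspace (top_of_set S). p z) \<subseteq> topspace X" by (auto simp: p_def)
      show "topspace X \<subseteq> (\<Union>z\<in>topspace (top_of_set S). p z)"
      proof
        fix x assume x: "x \<in> topspace X"
        then obtain I where I: "x \<in> (\<Inter>n\<in>I. F n)"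
            "metrizable_space (subtopology X (\<Inter>n\<in>I. F n))"
          using cov by blast
        have p: "p (indicator I) = topspace X \<inter> (\<Inter>n\<in>I. F n)"
          by (auto simp: p_def indicator_def)
        then have "indicator I \<in> S"
          using I(2) by (simp add: S_def subtopology_restrict)
        moreover have "x \<in> p (indicator I)" using x I(1) p by simp
        ultimately show "x \<in> (\<Union>z\<in>topspace (top_of_set S). p z)" by auto
      qed
    qed
    show "upper_semicontinuous_set_valued (top_of_set S) X p"
      unfolding upper_semicontinuous_set_valued_def
    proof (intro allI impI)
      fix U assume U: "openin X U"
      \<comment> \<open>By compactness, \<open>p z\<close> lies in \<open>U\<close> exactly when
        some \<open>J\<close> in \<open>\<J>\<close> consists of nonzero coordinates of
        \<open>z\<close>. Each such \<open>J\<close> is finite, so this is a union of open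
        cylinders.\<close>
      define \<J> where "\<J> = {J. finite J \<and> topspace X \<inter> (\<Inter>n\<in>J. F n) \<subseteq> U}"
      have "open (\<Union>J\<in>\<J>. {z :: nat \<Rightarrow> real. \<forall>n\<in>J. z n \<noteq> 0})"
        by (auto simp: \<J>_def intro!: open_Collect_coords_neq)
      moreover have "{z \<in> topspace (top_of_set S). p z \<subseteq> U}
          = S \<inter> (\<Union>J\<in>\<J>. {z. \<forall>n\<in>J. z n \<noteq> 0})"
      proof (intro equalityI subsetI)
        fix z assume z: "z \<in> {z \<in> topspace (top_of_set S). p z \<subseteq> U}"
        obtain J where "finite J" "J \<subseteq> {n. z n \<noteq> 0}" "topspace X \<inter> (\<Inter>n\<in>J. F n) \<subseteq> U"
          by (rule compact_space_finite_Inter_subset[where I = "{n. z n \<noteq> 0}", OF X F U])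
            (use z in \<open>auto simp: p_def\<close>)
        then show "z \<in> S \<inter> (\<Union>J\<in>\<J>. {z. \<forall>n\<in>J. z n \<noteq> 0})"
          using z by (auto simp: \<J>_def)
      next
        fix z assume "z \<in> S \<inter> (\<Union>J\<in>\<J>. {z. \<forall>n\<in>J. z n \<noteq> 0})"
        then obtain J where J: "z \<in> S" "topspace X \<inter> (\<Inter>n\<in>J. F n) \<subseteq> U" "\<forall>n\<in>J. z n \<noteq> 0"
          by (auto simp: \<J>_def)
        then have "p z \<subseteq> topspace X \<inter> (\<Inter>n\<in>J. F n)" by (auto simp: p_def)
        then show "z \<in> {z \<in> topspace (top_of_set S). p z \<subseteq> U}"
          using J(1,2) by (auto intro: subset_trans)
      qed
      ultimately show "openin (top_of_set S) {z \<in> topspace (top_of_set S). p z \<subseteq> U}"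
        by (simp add: openin_open_Int)
    qed
  qed
  then show ?thesis by (rule LSigma_le_omega_spaceI)
qed

text \<open>Pull back a countable basis along \<open>h\<close>: the finite image of \<open>T\<close>
  is closed and, by injectivity, misses \<open>h a\<close>.\<close>

lemma countable_separating_family:
  fixes h :: "'a \<Rightarrow> 'b::{second_countable_topology, t1_space}"
  assumes h: "inj_on h A"
  shows "\<exists>B :: nat \<Rightarrow> 'a set.
    \<forall>a\<in>A. \<forall>T\<subseteq>A. finite T \<and> a \<notin> T \<longrightarrow> (\<exists>m. a \<in> B m \<and> B m \<inter> T = {})"
proof -
  obtain \<B> :: "'b set set" where \<B>: "countable \<B>" "topological_basis \<B>"
    using ex_countable_basis by blast
  define B where "B m = h -` from_nat_into \<B> m" for m
  have "\<exists>m. a \<in> B m \<and> B m \<inter> T = {}"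
    if a: "a \<in> A" "finite T" "T \<subseteq> A" "a \<notin> T" for a T
  proof -
    have "open (- (h ` T))" using a by (simp add: finite_imp_closed open_Compl)
    moreover have "h a \<in> - (h ` T)" using a h by (auto dest: inj_onD)
    ultimately obtain V where V: "V \<in> \<B>" "h a \<in> V" "V \<subseteq> - (h ` T)"
      by (rule topological_basisE[OF \<B>(2)])
    obtain m where "from_nat_into \<B> m = V"
      using from_nat_into_surj[OF \<B>(1) V(1)] by blast
    then show ?thesis using V by (intro exI[of _ m]) (auto simp: B_def)
  qed
  then show ?thesis by blast
qed

text \<open>Code \<open>a\<close> by a chosen \<open>x\<close> with \<open>a\<close> in
  \<open>S x\<close>, together with the position of \<open>a\<close> in an enumeration of
  \<open>S x\<close>. The plane serves as target since it has a countable basis, as the separating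
  family requires.\<close>

lemma inj_on_UN_countable:
  fixes g :: "'b \<Rightarrow> real"
  assumes g: "inj_on g K" and S: "\<And>x. x \<in> K \<Longrightarrow> countable (S x)"
  shows "\<exists>h :: 'a \<Rightarrow> real \<times> real. inj_on h (\<Union>x\<in>K. S x)"
proof -
  have "\<forall>a\<in>\<Union>x\<in>K. S x. \<exists>x. x \<in> K \<and> a \<in> S x" by auto
  then obtain c where c: "\<And>a. a \<in> (\<Union>x\<in>K. S x) \<Longrightarrow> c a \<in> K \<and> a \<in> S (c a)"
    by metis
  have "inj_on (\<lambda>a. (g (c a), real (to_nat_on (S (c a)) a))) (\<Union>x\<in>K. S x)"
  proof (rule inj_onI)
    fix a b assume a: "a \<in> (\<Union>x\<in>K. S x)" and b: "b \<in> (\<Union>x\<in>K. S x)"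
      and eq: "(g (c a), real (to_nat_on (S (c a)) a)) = (g (c b), real (to_nat_on (S (c b)) b))"
    have "c a = c b" using eq c[OF a] c[OF b] g by (auto dest: inj_onD)
    then show "a = b"
      using eq c[OF a] c[OF b] S by (auto dest: inj_onD[OF inj_on_to_nat_on])
  qed
  then show ?thesis by blast
qed

text \<open>Points of \<open>L\<close> vanish on \<Gamma> outside \<open>C\<close>, so restriction
  to \<open>C\<close> is injective on \<open>L\<close>. A continuous injection of a compact space
  into a Hausdorff space is an embedding, here into a countable power of the line.\<close>

lemma metrizable_space_countable_support:
  fixes L :: "('a \<Rightarrow> real) set"
  assumes L: "compactin (product_topology (\<lambda>_. euclideanreal) \<Gamma>) L"
    and C: "countable C" "C \<subseteq> \<Gamma>" and supp: "\<And>y. y \<in> L \<Longrightarrow> supp_on \<Gamma> y \<subseteq> C"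
  shows "metrizable_space (subtopology (product_topology (\<lambda>_. euclideanreal) \<Gamma>) L)"
proof -
  let ?P = "\<lambda>I :: 'a set. product_topology (\<lambda>_. euclideanreal) I"
  let ?r = "\<lambda>y. restrict y C"
  have LE: "L \<subseteq> \<Gamma> \<rightarrow>\<^sub>E UNIV" using L compactin_subset_topspace by fastforce
  have mC: "metrizable_space (?P C)"
  proof -
    have "countable {i \<in> C. \<not> (\<exists>a. topspace euclideanreal \<subseteq> {a})}"
      by (rule countable_subset[OF _ C(1)]) auto
    then show ?thesis by (simp add: metrizable_space_product_topology metrizable_space_euclidean)
  qed
  have cont: "continuous_map (subtopology (?P \<Gamma>) L) (?P C) ?r"
    unfolding continuous_map_componentwise
    using C(2) continuous_map_product_coordinates[of _ \<Gamma> "\<lambda>_. euclideanreal"]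
    by (auto intro!: continuous_map_from_subtopology)
  have inj: "inj_on ?r (topspace (subtopology (?P \<Gamma>) L))"
  proof (rule inj_onI)
    fix y y' assume "y \<in> topspace (subtopology (?P \<Gamma>) L)" "y' \<in> topspace (subtopology (?P \<Gamma>) L)"
      and eq: "restrict y C = restrict y' C"
    then have y: "y \<in> L" "y' \<in> L" by auto
    show "y = y'"
    proof (rule PiE_ext[of y \<Gamma> "\<lambda>_. UNIV"])
      fix i assume i: "i \<in> \<Gamma>"
      show "y i = y' i"
      proof (cases "i \<in> C")
        case True
        then show ?thesis using eq by (metis restrict_apply')
      next
        case False
        then have "y i = 0" "y' i = 0" using supp[OF y(1)] supp[OF y(2)] i
          by (auto simp: supp_on_def)
        then show ?thesis by simp
      qed
    qed (use y LE in auto)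
  qed
  have "closed_map (subtopology (?P \<Gamma>) L) (?P C) ?r"
    using cont L metrizable_imp_Hausdorff_space[OF mC]
    by (intro continuous_imp_closed_map) (auto simp: compact_space_subtopology)
  then have "embedding_map (subtopology (?P \<Gamma>) L) (?P C) ?r"
    using cont inj by (intro injective_closed_imp_embedding_map)
  then show ?thesis
    using mC embedding_map_imp_homeomorphic_space homeomorphic_metrizable_space
      metrizable_space_subtopology by metis
qed

lemma closedin_vanishing_product:
  assumes "A \<subseteq> \<Gamma>"
  shows "closedin (product_topology (\<lambda>_. euclideanreal) \<Gamma>)
    {y \<in> \<Gamma> \<rightarrow>\<^sub>E UNIV. \<forall>\<gamma>\<in>A. y \<gamma> = 0}"
proof -
  let ?P = "product_topology (\<lambda>_. euclideanreal) \<Gamma>"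
  have *: "closedin ?P {y \<in> topspace ?P. y \<gamma> \<in> {0}}" if "\<gamma> \<in> A" for \<gamma>
    using that assms continuous_map_product_coordinates[of \<gamma> \<Gamma> "\<lambda>_. euclideanreal"]
    by (intro closedin_continuous_map_preimage[of _ euclideanreal]) auto
  \<comment> \<open>Inserting the whole space covers the case of empty \<open>A\<close>.\<close>
  have "closedin ?P (\<Inter>(insert (topspace ?P) ((\<lambda>\<gamma>. {y \<in> topspace ?P. y \<gamma> \<in> {0}}) ` A)))"
    using * closedin_topspace[of ?P]
    by (intro closedin_Inter) (auto simp del: topspace_product_topology)
  moreover have "\<Inter>(insert (topspace ?P) ((\<lambda>\<gamma>. {y \<in> topspace ?P. y \<gamma> \<in> {0}}) ` A))
      = {y \<in> \<Gamma> \<rightarrow>\<^sub>E UNIV. \<forall>\<gamma>\<in>A. y \<gamma> = 0}"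
    by auto
  ultimately show ?thesis by simp
qed

theorem theorem5p2:
  fixes \<Gamma> :: "'a set" and K :: "('a \<Rightarrow> real) set"
  assumes "compactin (Sigma_product \<Gamma>) K"
    and "K \<lesssim> (UNIV :: real set)"
    and "property_E2_aleph1 \<Gamma> K"
  shows "LSigma_le_omega_space (subtopology (Sigma_product \<Gamma>) K)"
proof -
  let ?P = "product_topology (\<lambda>_. euclideanreal) \<Gamma>"
  have KS: "K \<subseteq> {x \<in> \<Gamma> \<rightarrow>\<^sub>E UNIV. countable (supp_on \<Gamma> x)}" and KP: "compactin ?P K"
    using assms(1) by (auto simp: Sigma_product_def compactin_subtopology)
  have X: "subtopology (Sigma_product \<Gamma>) K = subtopology ?P K"
    using KS by (simp add: Sigma_product_def subtopology_subtopology Int_absorb1)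
  obtain G where G: "\<And>n::nat. G n \<subseteq> \<Gamma>"
      "\<And>x. x \<in> K \<Longrightarrow> countable (\<Gamma> - (\<Union>n \<in> {n. finite (supp_on \<Gamma> x \<inter> G n)}. G n))"
    using assms(3) unfolding property_E2_aleph1_def by auto
  \<comment> \<open>\<Gamma> may be arbitrarily large, but \<Delta> has at most continuum many
    elements: it is a union of countable supports over \<open>K\<close>.\<close>
  define \<Delta> where "\<Delta> = (\<Union>x\<in>K. supp_on \<Gamma> x)"
  obtain g :: "('a \<Rightarrow> real) \<Rightarrow> real" where g: "inj_on g K"
    using assms(2) by (auto simp: lepoll_def)
  have "countable (supp_on \<Gamma> x)" if "x \<in> K" for x
    using that KS by auto
  then obtain h :: "'a \<Rightarrow> real \<times> real" where "inj_on h \<Delta>"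
    using inj_on_UN_countable[OF g] unfolding \<Delta>_def by metis
  then obtain B :: "nat \<Rightarrow> 'a set" where
      "\<forall>a\<in>\<Delta>. \<forall>T\<subseteq>\<Delta>. finite T \<and> a \<notin> T \<longrightarrow> (\<exists>m. a \<in> B m \<and> B m \<inter> T = {})"
    using countable_separating_family by metis
  then have B: "\<exists>m. a \<in> B m \<and> B m \<inter> T = {}"
    if "a \<in> \<Delta>" "finite T" "T \<subseteq> \<Delta>" "a \<notin> T" for a T
    using that by blast
  \<comment> \<open>The pairs \<open>(n, m)\<close> are enumerated to fit the sequence of closed
    sets in \<open>LSigma_le_omega_space_closed_family\<close>.\<close>
  define F where "F k = (case prod_decode k of (n, m) \<Rightarrow>
      K \<inter> {y \<in> \<Gamma> \<rightarrow>\<^sub>E UNIV. \<forall>\<gamma>\<in>G n \<inter> B m. y \<gamma> = 0})" for k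
  have Fcl: "closedin (subtopology ?P K) (F k)" for k
    using closedin_vanishing_product[of "G _ \<inter> B _" \<Gamma>] G(1)
    by (auto simp: F_def closedin_subtopology_Int_closed le_infI1 split: prod.splits)
  show ?thesis unfolding X
  proof (rule LSigma_le_omega_space_closed_family)
    show "compact_space (subtopology ?P K)" using KP by (rule compact_space_subtopology)
    fix x assume "x \<in> topspace (subtopology ?P K)"
    then have x: "x \<in> K" by simp
    \<comment> \<open>The second condition puts \<open>x\<close> itself into every selected set; the
      first allows \<open>B\<close> to separate points from the trace of the support on
      \<open>G n\<close>.\<close>
    define I where "I = prod_encode `
      {(n, m). finite (supp_on \<Gamma> x \<inter> G n) \<and> supp_on \<Gamma> x \<inter> G n \<inter> B m = {}}"
    define L where "L = K \<inter> (\<Inter>k\<in>I. F k)"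
    \<comment> \<open>The second piece is countable by the property of \<open>G\<close>; it collects
      the coordinates that no \<open>G n\<close> with finite trace controls.\<close>
    define C where
      "C = supp_on \<Gamma> x \<union> (\<Gamma> - (\<Union>n \<in> {n. finite (supp_on \<Gamma> x \<inter> G n)}. G n))"
    have xF: "x \<in> (\<Inter>k\<in>I. F k)"
    proof -
      have "x \<gamma> = 0" if "supp_on \<Gamma> x \<inter> G n \<inter> B m = {}" "\<gamma> \<in> G n" "\<gamma> \<in> B m" for n m \<gamma>
        using that G(1)[of n] by (auto simp: supp_on_def)
      then show ?thesis using x KS by (auto simp: I_def F_def)
    qed
    have "closedin (subtopology ?P K) K"
      using closedin_topspace[of "subtopology ?P K"] compactin_subset_topspace[OF KP]
      by (simp add: Int_absorb1)
    then have "closedin (subtopology ?P K) (\<Inter>(insert K (F ` I)))"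
      using Fcl by (intro closedin_Inter) auto
    then have "compactin (subtopology ?P K) L"
      using KP by (simp add: L_def closedin_compact_space compact_space_subtopology)
    then have LP: "compactin ?P L" by (simp add: compactin_subtopology)
    have "supp_on \<Gamma> y \<subseteq> C" if y: "y \<in> L" for y
    proof
      fix \<gamma> assume \<gamma>: "\<gamma> \<in> supp_on \<Gamma> y"
      \<comment> \<open>Otherwise some \<open>B m\<close> contains \<gamma> and misses the finite
        trace of the support of \<open>x\<close> on \<open>G n\<close>. Then \<open>(n, m)\<close>
        is selected, which forces \<open>y\<close> to vanish at \<gamma>.\<close>
      have "\<gamma> \<in> supp_on \<Gamma> x" if n: "finite (supp_on \<Gamma> x \<inter> G n)" "\<gamma> \<in> G n" for n
      proof (rule ccontr)
        assume "\<gamma> \<notin> supp_on \<Gamma> x"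
        moreover have "\<gamma> \<in> \<Delta>" "supp_on \<Gamma> x \<inter> G n \<subseteq> \<Delta>"
          using \<gamma> x y by (auto simp: \<Delta>_def L_def)
        ultimately obtain m where m: "\<gamma> \<in> B m" "B m \<inter> (supp_on \<Gamma> x \<inter> G n) = {}"
          using B[OF _ n(1)] by blast
        then have "prod_encode (n, m) \<in> I" using n by (auto simp: I_def)
        then have "y \<in> F (prod_encode (n, m))" using y by (auto simp: L_def)
        then have "y \<gamma> = 0" using n m by (auto simp: F_def)
        then show False using \<gamma> by (auto simp: supp_on_def)
      qed
      then show "\<gamma> \<in> C" using \<gamma> by (auto simp: C_def supp_on_def)
    qed
    moreover have "countable C" "C \<subseteq> \<Gamma>"
      using x KS G(2) by (auto simp: C_def supp_on_def)
    ultimately have "metrizable_space (subtopology ?P L)"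
      using LP metrizable_space_countable_support by blast
    then have "metrizable_space (subtopology (subtopology ?P K) (\<Inter>k\<in>I. F k))"
      by (simp add: subtopology_subtopology L_def)
    then show "\<exists>I. x \<in> (\<Inter>k\<in>I. F k) \<and>
        metrizable_space (subtopology (subtopology ?P K) (\<Inter>k\<in>I. F k))"
      using xF by blast
  qed (rule Fcl)
qed

end
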